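(* Let $f_1,\dots,f_m$ be $\beta$-smooth convex functions on $\mathbb{R}^n$, $f=\frac1m\sum_{i=1}^mf_i$, and assume that $f$ is $\alpha$-strongly convex, $\alpha,\beta>0$, with minimizer $x^*$. Let $\kappa=\beta/\alpha$, $\eta=\frac{1}{10\beta}$ and $k=20\kappa$ (assumed to be an integer). Let SVRG be defined as follows: $y^{(1)}\in\mathbb{R}^n$ is arbitrary (deterministic); for $s=1,2,\dots$ let $x_1^{(s)}=y^{(s)}$, for $t=1,\dots,k$ let $$x_{t+1}^{(s)}=x_t^{(s)}-\eta\left(\nabla f_{i_t^{(s)}}(x_t^{(s)})-\nabla f_{i_t^{(s)}}(y^{(s)})+\nabla f(y^{(s)})\right),$$ where $i_t^{(s)}$ is drawn uniformly at random in $\{1,\dots,m\}$, independently of everything else, and let $y^{(s+1)}=\frac1k\sum_{t=1}^kx_t^{(s)}$. Then for every $s\ge 1$, $$\mathbb{E}f(y^{(s+1)})-f(x^* )\le 0.9^s\left(f(y^{(1)})-f(x^* )\right).$$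
   Context: $\|\cdot\|_2$ is the Euclidean norm. A continuously differentiable function $h$ is $\beta$-smooth if $\|\nabla h(x)-\nabla h(y)\|_2\le\beta\|x-y\|_2$ for all $x,y$, and $\alpha$-strongly convex if $h(x)-h(y)\le\nabla h(x)^\top(x-y)-\frac\alpha2\|x-y\|_2^2$ for all $x,y$. *)

theory Defs
  imports "HOL-Probability.Probability"
begin

(* Only meaningful where h is differentiable; elsewhere THE returns an unspecified vector. *)
definition grad :: "('a::real_inner \<Rightarrow> real) \<Rightarrow> 'a \<Rightarrow> 'a" where
  "grad h x = (THE D. GDERIV h x :> D)"

definition continuously_differentiable :: "('a::real_inner \<Rightarrow> real) \<Rightarrow> bool" where
  "continuously_differentiable h \<longleftrightarrow>
     (\<forall>x. h differentiable (at x)) \<and> continuous_on UNIV (grad h)"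

definition smooth :: "real \<Rightarrow> ('a::real_inner \<Rightarrow> real) \<Rightarrow> bool" where
  "smooth \<beta> h \<longleftrightarrow> continuously_differentiable h \<and>
     (\<forall>x y. norm (grad h x - grad h y) \<le> \<beta> * norm (x - y))"

definition strongly_convex :: "real \<Rightarrow> ('a::real_inner \<Rightarrow> real) \<Rightarrow> bool" where
  "strongly_convex \<alpha> h \<longleftrightarrow> continuously_differentiable h \<and>
     (\<forall>x y. h x - h y \<le> grad h x \<bullet> (x - y) - \<alpha> / 2 * (norm (x - y))\<^sup>2)"

(* Sequences produced by SVRG from one realisation i s t of the random indices, where f is the
   averaged objective and fs its summands; x s t is the t-th inner iterate of epoch s.
   Epochs and inner steps are counted from 1, so values of i, x, y at index 0 play no role. *)
definition svrg_run ::
  "real \<Rightarrow> nat \<Rightarrow> (nat \<Rightarrow> 'a::real_inner \<Rightarrow> real) \<Rightarrow> ('a \<Rightarrow> real) \<Rightarrow> 'a \<Rightarrow>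
   (nat \<Rightarrow> nat \<Rightarrow> nat) \<Rightarrow> (nat \<Rightarrow> nat \<Rightarrow> 'a) \<Rightarrow> (nat \<Rightarrow> 'a) \<Rightarrow> bool" where
  "svrg_run \<eta> k fs f y1 i x y \<longleftrightarrow>
     y 1 = y1 \<and>
     (\<forall>s\<ge>1. x s 1 = y s \<and>
        (\<forall>t\<in>{1..k}. x s (t + 1) =
           x s t - \<eta> *\<^sub>R (grad (fs (i s t)) (x s t) - grad (fs (i s t)) (y s) + grad f (y s))) \<and>
        y (s + 1) = (1 / real k) *\<^sub>R (\<Sum>t = 1..k. x s t))"

end

theory Submission
  imports Defs
begin

text \<open>
  Write \<open>f\<^sup>*\<close> for the minimum of \<open>f\<close>. The variance reduction rests on one estimate: for a convex
  \<open>\<beta>\<close>-smooth function the squared distance between the gradients at \<open>x\<close> and at the minimizer is at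
  most \<open>2\<beta>\<close> times the gap between the function and its tangent at the minimizer
  (\<open>norm_grad_diff_le_bregman\<close>). Averaged over the summands the tangents cancel, since the gradient
  of \<open>f\<close> vanishes at the minimizer. Hence the random direction of an inner step, which is an
  unbiased estimate of the gradient of \<open>f\<close> at the current iterate \<open>x\<close>, has second moment at most
  \<open>4\<beta>\<close> times the sum of the suboptimalities of \<open>x\<close> and of the snapshot \<open>y\<close>: the noise dies out
  as both approach the minimizer, and a constant step size is affordable.

  Expanding the square of the distance to the minimizer, one step therefore satisfies, on average
  over its index (\<open>average_step_le\<close>),
  \<open>dist(x')\<^sup>2 \<le> dist(x)\<^sup>2 - 2\<eta>(1 - 2\<beta>\<eta>)(f(x) - f\<^sup>*) + 4\<beta>\<eta>\<^sup>2(f(y) - f\<^sup>*)\<close>.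
  Summing over the \<open>k\<close> steps of an epoch, the distances telescope. The initial one is at most
  \<open>2/\<alpha>\<close> times the suboptimality of \<open>y\<close> by strong convexity, and the suboptimality of the
  average iterate is at most the average suboptimality by convexity. So an epoch multiplies the
  expected suboptimality by \<open>1/(\<alpha>\<eta>(1 - 2\<beta>\<eta>)k) + 2\<beta>\<eta>/(1 - 2\<beta>\<eta>)\<close> (\<open>expected_epoch_le\<close>),
  which for \<open>\<eta> = 1/(10\<beta>)\<close> and \<open>k = 20\<beta>/\<alpha>\<close> is \<open>5/8 + 1/4 = 7/8\<close>.

  The probability needed is elementary, because each iterate is a function of finitely many earlier
  indices. Such a function takes almost surely finitely many values, so it is integrable whatever
  the function is, and an index outside the past is independent of it, so the expectation over that
  index is a plain average over \<open>{1..m}\<close> (\<open>expectation_fresh_index\<close>). This replaces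
  conditional expectations and any discussion of measurability of the gradients.
\<close>

section \<open>Gradients of smooth convex functions\<close>

lemma grad_eqI:
  assumes "GDERIV h x :> D"
  shows "grad h x = D"
  unfolding grad_def
proof (rule the_equality)
  fix E assume "GDERIV h x :> E"
  then have "(\<lambda>v. v \<bullet> E) = (\<lambda>v. v \<bullet> D)"
    using assms unfolding gderiv_def by (rule has_derivative_unique)
  then have "(E - D) \<bullet> E = (E - D) \<bullet> D" by meson
  then have "(E - D) \<bullet> (E - D) = 0" by (simp add: inner_diff_right)
  then show "E = D" by simp
qed (fact assms)

text \<open>
  Differentiability is stated by a linear functional; in finite dimension its Riesz representative
  is read off from its values on the basis.
\<close>
lemma GDERIV_grad:
  fixes h :: "'a::euclidean_space \<Rightarrow> real"
  assumes "h differentiable (at x)"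
  shows "GDERIV h x :> grad h x"
proof -
  obtain h' where h': "(h has_derivative h') (at x)"
    using assms unfolding differentiable_def by blast
  then have lin: "linear h'" by (rule has_derivative_linear)
  have "h' v = v \<bullet> (\<Sum>b\<in>Basis. h' b *\<^sub>R b)" for v
  proof -
    have "h' v = h' (\<Sum>b\<in>Basis. (v \<bullet> b) *\<^sub>R b)" by (simp add: euclidean_representation)
    also have "\<dots> = (\<Sum>b\<in>Basis. (v \<bullet> b) * h' b)"
      by (simp add: linear_sum[OF lin] linear_scale[OF lin])
    finally show ?thesis by (simp add: inner_sum_right mult.commute)
  qed
  then have "h' = (\<lambda>v. v \<bullet> (\<Sum>b\<in>Basis. h' b *\<^sub>R b))" by blast
  then have "GDERIV h x :> (\<Sum>b\<in>Basis. h' b *\<^sub>R b)"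
    using h' unfolding gderiv_def by metis
  then show ?thesis using grad_eqI by metis
qed

lemma GDERIV_grad_of_smooth:
  fixes h :: "'a::euclidean_space \<Rightarrow> real"
  assumes "smooth \<beta> h"
  shows "GDERIV h x :> grad h x"
  using assms GDERIV_grad unfolding smooth_def continuously_differentiable_def by blast

lemma GDERIV_sum:
  assumes "\<And>j. j \<in> J \<Longrightarrow> GDERIV (h j) x :> D j"
  shows "GDERIV (\<lambda>z. \<Sum>j\<in>J. h j z) x :> (\<Sum>j\<in>J. D j)"
  using assms unfolding gderiv_def inner_sum_right by (intro has_derivative_sum)

lemma DERIV_along_line:
  assumes "GDERIV h (x + t *\<^sub>R d) :> D"
  shows "((\<lambda>t. h (x + t *\<^sub>R d)) has_real_derivative d \<bullet> D) (at t)"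
proof -
  have "((\<lambda>t. x + t *\<^sub>R d) has_derivative (\<lambda>t. t *\<^sub>R d)) (at t)"
    by (auto intro!: derivative_eq_intros)
  from has_derivative_compose[OF this assms[unfolded gderiv_def]]
  show ?thesis unfolding has_field_derivative_def by (simp add: mult_commute_abs)
qed

text \<open>
  On the segment from \<open>x\<close> to \<open>y\<close> the slope of \<open>h\<close> exceeds its initial value by at most
  \<open>\<beta> t (norm (y - x))\<^sup>2\<close>. Instead of integrating this bound, the proof subtracts its antiderivative
  and observes that the remainder \<open>\<psi>\<close> is nonincreasing.
\<close>
lemma descent_lemma:
  fixes h :: "'a::euclidean_space \<Rightarrow> real"
  assumes "smooth \<beta> h"
  shows "h y \<le> h x + grad h x \<bullet> (y - x) + \<beta> / 2 * (norm (y - x))\<^sup>2"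
proof -
  define d where "d = y - x"
  define \<psi> where "\<psi> t = h (x + t *\<^sub>R d) - t * (grad h x \<bullet> d) - \<beta> / 2 * t\<^sup>2 * (norm d)\<^sup>2" for t
  have "\<psi> 1 \<le> \<psi> 0"
  proof (rule DERIV_nonpos_imp_nonincreasing[of 0 1 \<psi>])
    fix t :: real assume t: "0 \<le> t" "t \<le> 1"
    let ?D = "d \<bullet> grad h (x + t *\<^sub>R d) - grad h x \<bullet> d - \<beta> * t * (norm d)\<^sup>2"
    have "(\<psi> has_real_derivative ?D) (at t)"
      unfolding \<psi>_def
      by (auto intro!: derivative_eq_intros DERIV_along_line GDERIV_grad_of_smooth[OF assms])
    moreover have "?D \<le> 0"
    proof -
      have "d \<bullet> grad h (x + t *\<^sub>R d) - grad h x \<bullet> d = d \<bullet> (grad h (x + t *\<^sub>R d) - grad h x)"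
        by (simp add: inner_diff_right inner_commute)
      also have "\<dots> \<le> norm d * norm (grad h (x + t *\<^sub>R d) - grad h x)"
        by (rule norm_cauchy_schwarz)
      also have "\<dots> \<le> norm d * (\<beta> * norm (x + t *\<^sub>R d - x))"
        using assms unfolding smooth_def by (intro mult_left_mono norm_ge_zero) blast
      also have "\<dots> = \<beta> * t * (norm d)\<^sup>2"
        using t by (simp add: power2_eq_square)
      finally show ?thesis by simp
    qed
    ultimately show "\<exists>D. (\<psi> has_real_derivative D) (at t) \<and> D \<le> 0" by blast
  qed simp
  then show ?thesis by (simp add: \<psi>_def d_def)
qed

lemma convex_on_above_gradient:
  fixes h :: "'a::euclidean_space \<Rightarrow> real"
  assumes convex: "convex_on UNIV h" and D: "GDERIV h x :> D"
  shows "h x + D \<bullet> (y - x) \<le> h y"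
proof -
  define d where "d = y - x"
  define \<phi> where "\<phi> t = h (x + t *\<^sub>R d)" for t :: real
  have "convex_on UNIV \<phi>"
  proof (rule convex_onI)
    fix t a b :: real assume t: "0 < t" "t < 1"
    have "x + ((1 - t) *\<^sub>R a + t *\<^sub>R b) *\<^sub>R d = (1 - t) *\<^sub>R (x + a *\<^sub>R d) + t *\<^sub>R (x + b *\<^sub>R d)"
      by (simp add: algebra_simps)
    then show "\<phi> ((1 - t) *\<^sub>R a + t *\<^sub>R b) \<le> (1 - t) * \<phi> a + t * \<phi> b"
      unfolding \<phi>_def using convex_onD[OF convex, of t] t by simp
  qed simp
  moreover have "(\<phi> has_real_derivative d \<bullet> D) (at 0)"
    unfolding \<phi>_def using D by (intro DERIV_along_line) simp
  ultimately have "\<phi> 1 - \<phi> 0 \<ge> (d \<bullet> D) * (1 - 0)"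
    by (intro convex_on_imp_above_tangent[of UNIV]) auto
  then show ?thesis by (simp add: \<phi>_def d_def inner_commute)
qed

text \<open>
  The right-hand side measures how far \<open>h x\<close> lies above the tangent at \<open>z\<close>. The function \<open>h\<close>
  minus that tangent is nonnegative, by convexity, and still \<open>\<beta>\<close>-smooth; a gradient step of length
  \<open>1/\<beta>\<close> from \<open>x\<close>, leading to the point \<open>w\<close> of the proof, lowers it by at least
  \<open>(norm (grad h x - grad h z))\<^sup>2 / (2\<beta>)\<close>, so it was at least that large at \<open>x\<close>.
\<close>
lemma norm_grad_diff_le_bregman:
  fixes h :: "'a::euclidean_space \<Rightarrow> real"
  assumes smooth: "smooth \<beta> h" and convex: "convex_on UNIV h" and \<beta>: "\<beta> > 0"
  shows "(norm (grad h x - grad h z))\<^sup>2 \<le> 2 * \<beta> * (h x - h z - grad h z \<bullet> (x - z))"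
proof -
  define d where "d = grad h x - grad h z"
  define w where "w = x - (1 / \<beta>) *\<^sub>R d"
  have "h z + grad h z \<bullet> (w - z) \<le> h w"
    by (rule convex_on_above_gradient[OF convex GDERIV_grad_of_smooth[OF smooth]])
  also have "\<dots> \<le> h x + grad h x \<bullet> (w - x) + \<beta> / 2 * (norm (w - x))\<^sup>2"
    by (rule descent_lemma[OF smooth])
  also have "w - x = - ((1 / \<beta>) *\<^sub>R d)" by (simp add: w_def)
  also have "\<beta> / 2 * (norm (- ((1 / \<beta>) *\<^sub>R d)))\<^sup>2 = (d \<bullet> d) / (2 * \<beta>)"
    using \<beta> by (simp add: power_mult_distrib power_divide flip: power2_norm_eq_inner)
        (simp add: power2_eq_square)
  finally have "grad h x \<bullet> d / \<beta> - grad h z \<bullet> d / \<beta> - (d \<bullet> d) / (2 * \<beta>) \<le> h x - h z - grad h z \<bullet> (x - z)"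
    by (simp add: w_def inner_diff_right)
  moreover have "grad h x \<bullet> d / \<beta> - grad h z \<bullet> d / \<beta> = (d \<bullet> d) / \<beta>"
    by (simp add: d_def inner_diff_left diff_divide_distrib)
  ultimately have "(d \<bullet> d) / (2 * \<beta>) \<le> h x - h z - grad h z \<bullet> (x - z)"
    by simp
  then show ?thesis
    using \<beta> by (simp add: field_simps power2_norm_eq_inner d_def)
qed

lemma grad_minimizer_eq_0:
  fixes h :: "'a::euclidean_space \<Rightarrow> real"
  assumes D: "GDERIV h x :> D" and min: "\<And>z. h x \<le> h z"
  shows "D = 0"
proof -
  have "((\<lambda>t. h (x + t *\<^sub>R D)) has_real_derivative D \<bullet> D) (at 0)"
    using D by (intro DERIV_along_line) simp
  then have "D \<bullet> D = 0"
    by (rule DERIV_local_min[where d = 1]) (auto simp: min)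
  then show ?thesis by simp
qed

text \<open>The variance is at most the second moment.\<close>
lemma sum_norm_sq_centered_le:
  fixes b :: "'i \<Rightarrow> 'a::real_inner"
  assumes "(\<Sum>j\<in>J. b j) = real (card J) *\<^sub>R c"
  shows "(\<Sum>j\<in>J. (norm (b j - c))\<^sup>2) \<le> (\<Sum>j\<in>J. (norm (b j))\<^sup>2)"
proof -
  have "(\<Sum>j\<in>J. (norm (b j - c))\<^sup>2) = (\<Sum>j\<in>J. (norm (b j))\<^sup>2 - 2 * (b j \<bullet> c) + c \<bullet> c)"
    by (simp add: power2_norm_eq_inner inner_diff_left inner_diff_right inner_commute algebra_simps)
  also have "\<dots> = (\<Sum>j\<in>J. (norm (b j))\<^sup>2) - 2 * ((\<Sum>j\<in>J. b j) \<bullet> c) + real (card J) * (c \<bullet> c)"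
    by (simp add: sum.distrib sum_subtractf sum_distrib_left inner_sum_left)
  also have "\<dots> = (\<Sum>j\<in>J. (norm (b j))\<^sup>2) - real (card J) * (c \<bullet> c)"
    by (simp add: assms)
  finally show ?thesis by simp
qed

lemma norm_sq_diff_le:
  fixes a b :: "'a::real_inner"
  shows "(norm (a - b))\<^sup>2 \<le> 2 * (norm a)\<^sup>2 + 2 * (norm b)\<^sup>2"
proof -
  have "2 * (norm a)\<^sup>2 + 2 * (norm b)\<^sup>2 - (norm (a - b))\<^sup>2 = (norm (a + b))\<^sup>2"
    by (simp add: power2_norm_eq_inner inner_diff_left inner_diff_right inner_add_left
        inner_add_right inner_commute algebra_simps)
  then show ?thesis by (metis diff_ge_0_iff_ge zero_le_power2)
qed

section \<open>One variance-reduced step\<close>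

locale smooth_finite_sum =
  fixes fs :: "nat \<Rightarrow> 'a::euclidean_space \<Rightarrow> real" and f :: "'a \<Rightarrow> real"
    and m :: nat and \<alpha> \<beta> :: real and xstar :: 'a
  assumes m: "m \<ge> 1" and \<alpha>: "\<alpha> > 0" and \<beta>: "\<beta> > 0"
    and smooth: "\<And>j. j \<in> {1..m} \<Longrightarrow> smooth \<beta> (fs j)"
    and convex: "\<And>j. j \<in> {1..m} \<Longrightarrow> convex_on UNIV (fs j)"
    and f: "f = (\<lambda>z. 1 / real m * (\<Sum>j = 1..m. fs j z))"
    and strongly_convex: "strongly_convex \<alpha> f"
    and minimizer: "\<And>z. f xstar \<le> f z"
begin

lemma sum_fs: "(\<Sum>j = 1..m. fs j z) = m * f z"
  using m by (simp add: f)

lemma GDERIV_f: "GDERIV f x :> grad f x"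
  using strongly_convex GDERIV_grad
  unfolding strongly_convex_def continuously_differentiable_def by blast

lemma sum_grad: "(\<Sum>j = 1..m. grad (fs j) x) = real m *\<^sub>R grad f x"
proof -
  have "GDERIV (\<lambda>z. \<Sum>j = 1..m. fs j z) x :> (\<Sum>j = 1..m. grad (fs j) x)"
    by (intro GDERIV_sum GDERIV_grad_of_smooth[OF smooth])
  moreover have "GDERIV (\<lambda>z. real m * f z) x :> real m *\<^sub>R grad f x"
    using GDERIV_mult[OF GDERIV_const GDERIV_f, of "real m" x] by simp
  ultimately show ?thesis
    unfolding sum_fs by (metis grad_eqI)
qed

lemma grad_xstar: "grad f xstar = 0"
  using GDERIV_f minimizer by (rule grad_minimizer_eq_0)

lemma f_above_gradient: "f x + grad f x \<bullet> (y - x) \<le> f y"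
proof -
  have "f x - f y \<le> grad f x \<bullet> (x - y) - \<alpha> / 2 * (norm (x - y))\<^sup>2"
    using strongly_convex unfolding strongly_convex_def by blast
  also have "\<dots> \<le> grad f x \<bullet> (x - y)" using \<alpha> by simp
  finally show ?thesis by (simp add: inner_diff_right)
qed

lemma dist_xstar_le: "(norm (x - xstar))\<^sup>2 \<le> 2 / \<alpha> * (f x - f xstar)"
proof -
  have "f xstar - f x \<le> grad f xstar \<bullet> (xstar - x) - \<alpha> / 2 * (norm (xstar - x))\<^sup>2"
    using strongly_convex unfolding strongly_convex_def by blast
  then show ?thesis
    using \<alpha> by (simp add: grad_xstar norm_minus_commute field_simps)
qed

text \<open>Jensen's inequality, by adding up the tangent bounds at the average: their linear parts cancel.\<close>
lemma f_average_le:
  assumes "k \<ge> 1"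
  shows "f ((1 / real k) *\<^sub>R (\<Sum>t = 1..k. z t)) \<le> 1 / real k * (\<Sum>t = 1..k. f (z t))"
proof -
  define c where "c = (1 / real k) *\<^sub>R (\<Sum>t = 1..k. z t)"
  have c: "(\<Sum>t = 1..k. z t) = real k *\<^sub>R c" using assms by (simp add: c_def)
  have "(\<Sum>t = 1..k. f c + grad f c \<bullet> (z t - c)) \<le> (\<Sum>t = 1..k. f (z t))"
    by (intro sum_mono f_above_gradient)
  also have "(\<Sum>t = 1..k. f c + grad f c \<bullet> (z t - c))
      = k * f c + grad f c \<bullet> ((\<Sum>t = 1..k. z t) - real k *\<^sub>R c)"
    by (simp add: sum.distrib sum_subtractf inner_diff_right inner_sum_right)
  finally have "k * f c \<le> (\<Sum>t = 1..k. f (z t))" by (simp add: c del: One_nat_def)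
  then show ?thesis unfolding c_def[symmetric] using assms by (simp add: field_simps)
qed

text \<open>
  The tangent terms of \<open>norm_grad_diff_le_bregman\<close> add up to the gradient of \<open>f\<close> at its minimizer,
  so only function values survive.
\<close>
lemma sum_norm_grad_diff_le:
  "(\<Sum>j = 1..m. (norm (grad (fs j) x - grad (fs j) xstar))\<^sup>2) \<le> m * (2 * \<beta> * (f x - f xstar))"
proof -
  have "(\<Sum>j = 1..m. (norm (grad (fs j) x - grad (fs j) xstar))\<^sup>2)
      \<le> (\<Sum>j = 1..m. 2 * \<beta> * (fs j x - fs j xstar - grad (fs j) xstar \<bullet> (x - xstar)))"
    by (intro sum_mono norm_grad_diff_le_bregman smooth convex \<beta>)
  also have "\<dots> = 2 * \<beta> * ((\<Sum>j = 1..m. fs j x) - (\<Sum>j = 1..m. fs j xstar)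
      - (\<Sum>j = 1..m. grad (fs j) xstar) \<bullet> (x - xstar))"
    by (simp only: sum_distrib_left[symmetric] sum_subtractf inner_sum_left)
  also have "\<dots> = m * (2 * \<beta> * (f x - f xstar))"
    by (simp add: sum_grad grad_xstar sum_fs algebra_simps del: One_nat_def)
  finally show ?thesis .
qed

definition direction :: "nat \<Rightarrow> 'a \<Rightarrow> 'a \<Rightarrow> 'a" where
  "direction j x y = grad (fs j) x - grad (fs j) y + grad f y"

lemma sum_direction: "(\<Sum>j = 1..m. direction j x y) = real m *\<^sub>R grad f x"
  by (simp only: direction_def sum.distrib sum_subtractf sum_grad) (simp add: sum_constant_scaleR)

text \<open>
  The variance reduction. With both gradients of the \<open>j\<close>-th summand measured relative to the minimizer,
  the direction is the difference of the gradient at \<open>x\<close> and the centered gradient at \<open>y\<close>; the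
  centering costs nothing, and both parts are controlled by function values.
\<close>
lemma sum_norm_direction_le:
  "(\<Sum>j = 1..m. (norm (direction j x y))\<^sup>2) \<le> m * (4 * \<beta> * ((f x - f xstar) + (f y - f xstar)))"
proof -
  let ?a = "\<lambda>z j. grad (fs j) z - grad (fs j) xstar"
  have "direction j x y = ?a x j - (?a y j - grad f y)" for j
    by (simp add: direction_def)
  then have "(\<Sum>j = 1..m. (norm (direction j x y))\<^sup>2)
      \<le> (\<Sum>j = 1..m. 2 * (norm (?a x j))\<^sup>2 + 2 * (norm (?a y j - grad f y))\<^sup>2)"
    by (simp only:) (intro sum_mono norm_sq_diff_le)
  also have "\<dots> = 2 * (\<Sum>j = 1..m. (norm (?a x j))\<^sup>2) + 2 * (\<Sum>j = 1..m. (norm (?a y j - grad f y))\<^sup>2)"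
    by (simp only: sum.distrib sum_distrib_left)
  also have "(\<Sum>j = 1..m. (norm (?a y j - grad f y))\<^sup>2) \<le> (\<Sum>j = 1..m. (norm (?a y j))\<^sup>2)"
    by (rule sum_norm_sq_centered_le) (simp add: sum_subtractf sum_grad grad_xstar del: One_nat_def)
  finally show ?thesis
    using sum_norm_grad_diff_le[of x] sum_norm_grad_diff_le[of y] by (simp add: algebra_simps)
qed

lemma average_step_le:
  assumes \<eta>: "\<eta> \<ge> 0"
  shows "1 / real m * (\<Sum>j = 1..m. (norm (x - \<eta> *\<^sub>R direction j x y - xstar))\<^sup>2)
    \<le> (norm (x - xstar))\<^sup>2 - 2 * \<eta> * (1 - 2 * \<beta> * \<eta>) * (f x - f xstar)
        + 4 * \<beta> * \<eta>\<^sup>2 * (f y - f xstar)"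
proof -
  have "(norm (x - \<eta> *\<^sub>R v - xstar))\<^sup>2
      = (norm (x - xstar))\<^sup>2 - 2 * \<eta> * (v \<bullet> (x - xstar)) + \<eta>\<^sup>2 * (norm v)\<^sup>2" for v
    unfolding power2_norm_eq_inner
    by (simp add: power2_eq_square inner_diff_left inner_diff_right inner_commute algebra_simps)
  then have "(\<Sum>j = 1..m. (norm (x - \<eta> *\<^sub>R direction j x y - xstar))\<^sup>2)
     = m * (norm (x - xstar))\<^sup>2 - 2 * \<eta> * ((\<Sum>j = 1..m. direction j x y) \<bullet> (x - xstar))
        + \<eta>\<^sup>2 * (\<Sum>j = 1..m. (norm (direction j x y))\<^sup>2)"
    by (simp add: sum.distrib sum_subtractf sum_distrib_left inner_sum_left)
  also have "\<dots> = m * ((norm (x - xstar))\<^sup>2 - 2 * \<eta> * (grad f x \<bullet> (x - xstar)))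
        + \<eta>\<^sup>2 * (\<Sum>j = 1..m. (norm (direction j x y))\<^sup>2)"
    by (simp add: sum_direction algebra_simps del: One_nat_def)
  also have "\<dots> \<le> m * ((norm (x - xstar))\<^sup>2 - 2 * \<eta> * (f x - f xstar))
        + \<eta>\<^sup>2 * (m * (4 * \<beta> * ((f x - f xstar) + (f y - f xstar))))"
  proof (intro add_mono mult_left_mono diff_left_mono sum_norm_direction_le)
    show "f x - f xstar \<le> grad f x \<bullet> (x - xstar)"
      using f_above_gradient[of x xstar] by (simp add: inner_diff_right)
  qed (use \<eta> in auto)
  also have "\<dots> = m * ((norm (x - xstar))\<^sup>2 - 2 * \<eta> * (1 - 2 * \<beta> * \<eta>) * (f x - f xstar)
        + 4 * \<beta> * \<eta>\<^sup>2 * (f y - f xstar))"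
    by (simp add: algebra_simps power2_eq_square)
  finally show ?thesis using m by (simp add: field_simps)
qed

end

section \<open>Functions of finitely many independent uniform indices\<close>

locale uniform_indices = prob_space M for M :: "'w measure" +
  fixes I :: "'p \<Rightarrow> 'w \<Rightarrow> nat" and S :: "'p set" and m :: nat
  assumes m_pos: "m \<ge> 1"
    and indep: "indep_vars (\<lambda>_. count_space UNIV) I S"
    and uniform: "\<And>p. p \<in> S \<Longrightarrow>
      distr M (count_space UNIV) (I p) = measure_pmf (pmf_of_set {1..m})"
begin

text \<open>
  Being a function of the indices in \<open>A\<close>, phrased without naming that function: in this form it is
  immediate for everything computed from an iterate.
\<close>
definition determined_by :: "'p set \<Rightarrow> ('w \<Rightarrow> 'b) \<Rightarrow> bool" where
  "determined_by A X \<longleftrightarrow>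
     (\<forall>\<omega>\<in>space M. \<forall>\<omega>'\<in>space M. (\<forall>p\<in>A. I p \<omega> = I p \<omega>') \<longrightarrow> X \<omega> = X \<omega>')"

lemma index_measurable [measurable]: "p \<in> S \<Longrightarrow> I p \<in> measurable M (count_space UNIV)"
  using indep unfolding indep_vars_def by blast

lemma prob_index:
  assumes "p \<in> S" "j \<in> {1..m}"
  shows "prob (I p -` {j} \<inter> space M) = 1 / real m"
proof -
  have "prob (I p -` {j} \<inter> space M) = measure (distr M (count_space UNIV) (I p)) {j}"
    using assms by (subst measure_distr) auto
  also have "\<dots> = 1 / real m"
    using assms by (simp add: uniform measure_pmf_single)
  finally show ?thesis .
qed

lemma AE_index: "p \<in> S \<Longrightarrow> AE \<omega> in M. I p \<omega> \<in> {1..m}"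
proof -
  assume p: "p \<in> S"
  have "AE j in distr M (count_space UNIV) (I p). j \<in> {1..m}"
    using m_pos unfolding uniform[OF p] by (simp add: AE_measure_pmf_iff)
  then show ?thesis using p by (subst (asm) AE_distr_iff) auto
qed

lemma determined_by_factor:
  assumes "determined_by A X"
  obtains G where "\<And>\<omega>. \<omega> \<in> space M \<Longrightarrow> X \<omega> = G (\<lambda>p\<in>A. I p \<omega>)"
proof -
  define G where "G z = X (SOME \<omega>. \<omega> \<in> space M \<and> (\<lambda>p\<in>A. I p \<omega>) = z)" for z
  have "X \<omega> = G (\<lambda>p\<in>A. I p \<omega>)" if \<omega>: "\<omega> \<in> space M" for \<omega>
  proof -
    define \<omega>' where "\<omega>' = (SOME \<omega>'. \<omega>' \<in> space M \<and> (\<lambda>p\<in>A. I p \<omega>') = (\<lambda>p\<in>A. I p \<omega>))"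
    have "\<omega>' \<in> space M \<and> (\<lambda>p\<in>A. I p \<omega>') = (\<lambda>p\<in>A. I p \<omega>)"
      unfolding \<omega>'_def by (rule someI[of _ \<omega>]) (use \<omega> in simp)
    moreover from this have "\<forall>p\<in>A. I p \<omega> = I p \<omega>'" by (metis restrict_apply')
    ultimately show ?thesis
      using assms \<omega> unfolding determined_by_def G_def \<omega>'_def by blast
  qed
  then show ?thesis using that by blast
qed

lemma measurable_discrete_PiM:
  assumes "finite A"
  shows "G \<in> borel_measurable (Pi\<^sub>M A (\<lambda>_. count_space (UNIV :: nat set)))"
  using assms by (subst count_space_PiM_finite) auto

text \<open>
  Almost surely all indices in the finite set \<open>A\<close> lie in \<open>{1..m}\<close>, so that \<open>X\<close> takes finitely many
  values and is bounded. Measurability is automatic because finitely many natural numbers form a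
  countable discrete space.
\<close>
lemma determined_by_integrable:
  fixes X :: "'w \<Rightarrow> real"
  assumes X: "determined_by A X" and A: "finite A" "A \<subseteq> S"
  shows "integrable M X"
proof -
  obtain G where G: "\<And>\<omega>. \<omega> \<in> space M \<Longrightarrow> X \<omega> = G (\<lambda>p\<in>A. I p \<omega>)"
    using determined_by_factor[OF X] by blast
  let ?F = "PiE A (\<lambda>_. {1..m})"
  have past: "(\<lambda>\<omega>. \<lambda>p\<in>A. I p \<omega>) \<in> measurable M (Pi\<^sub>M A (\<lambda>_. count_space UNIV))"
    using A by (intro measurable_restrict index_measurable) auto
  have "integrable M (\<lambda>\<omega>. G (\<lambda>p\<in>A. I p \<omega>))"
  proof (rule integrable_const_bound)
    have "AE \<omega> in M. \<forall>p\<in>A. I p \<omega> \<in> {1..m}"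
      using A AE_index by (intro AE_finite_allI) auto
    \<comment> \<open>The sum over the finitely many typical values serves as a crude bound.\<close>
    then show "AE \<omega> in M. norm (G (\<lambda>p\<in>A. I p \<omega>)) \<le> (\<Sum>z\<in>?F. norm (G z))"
    proof eventually_elim
      case (elim \<omega>)
      then show ?case
        using A by (intro member_le_sum[of _ ?F "\<lambda>z. norm (G z)"] finite_PiE) auto
    qed
    show "(\<lambda>\<omega>. G (\<lambda>p\<in>A. I p \<omega>)) \<in> borel_measurable M"
      using measurable_compose[OF past measurable_discrete_PiM[OF A(1)]] .
  qed
  then show ?thesis using G by (subst Bochner_Integration.integrable_cong[OF refl]) auto
qed

text \<open>
  Averaging over an index that is independent of the rest. Splitting according to the value \<open>j\<close> of the
  fresh index, the event \<open>I p = j\<close> has probability \<open>1/m\<close> and is independent of \<open>X j\<close>, which involves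
  only the indices in \<open>A\<close>. The integrability assumption covers the null set on which the fresh index
  is outside \<open>{1..m}\<close>, where nothing is known about \<open>X\<close>.
\<close>
lemma expectation_fresh_index:
  fixes X :: "nat \<Rightarrow> 'w \<Rightarrow> real"
  assumes X: "\<And>j. j \<in> {1..m} \<Longrightarrow> determined_by A (X j)"
    and A: "finite A" "A \<subseteq> S" and p: "p \<in> S" "p \<notin> A"
    and Z: "integrable M (\<lambda>\<omega>. X (I p \<omega>) \<omega>)"
  shows "expectation (\<lambda>\<omega>. X (I p \<omega>) \<omega>) = 1 / real m * (\<Sum>j = 1..m. expectation (X j))"
proof -
  let ?ind = "\<lambda>j \<omega>. indicator {j} (I p \<omega>) :: real"
  have split: "integrable M (\<lambda>\<omega>. ?ind j \<omega> * X j \<omega>)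
      \<and> expectation (\<lambda>\<omega>. ?ind j \<omega> * X j \<omega>) = 1 / real m * expectation (X j)"
    if j: "j \<in> {1..m}" for j
  proof -
    obtain G where G: "\<And>\<omega>. \<omega> \<in> space M \<Longrightarrow> X j \<omega> = G (\<lambda>p\<in>A. I p \<omega>)"
      using determined_by_factor[OF X[OF j]] by blast
    let ?G = "G \<circ> (\<lambda>\<omega>. \<lambda>p\<in>A. I p \<omega>)"
    let ?H = "(\<lambda>z. indicator {j} (z p) :: real) \<circ> (\<lambda>\<omega>. \<lambda>p\<in>{p}. I p \<omega>)"
    have "indep_var (Pi\<^sub>M {p} (\<lambda>_. count_space UNIV)) (\<lambda>\<omega>. \<lambda>p\<in>{p}. I p \<omega>)
        (Pi\<^sub>M A (\<lambda>_. count_space UNIV)) (\<lambda>\<omega>. \<lambda>p\<in>A. I p \<omega>)"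
      using p A by (intro indep_var_restrict[OF indep]) auto
    then have ind: "indep_var borel ?H borel ?G"
      using A by (elim indep_var_compose) (auto intro: measurable_discrete_PiM)
    have H: "?H = ?ind j" by (auto simp: fun_eq_iff)
    have prob: "expectation (?ind j) = 1 / real m"
    proof -
      have "expectation (?ind j) = expectation (indicator (I p -` {j} \<inter> space M))"
        by (intro Bochner_Integration.integral_cong) (auto simp: indicator_def)
      also have "\<dots> = prob (I p -` {j} \<inter> space M)"
        by (simp add: Int_assoc)
      finally show ?thesis using prob_index[OF p(1) j] by simp
    qed
    have iH: "integrable M ?H"
      unfolding H using p by (intro integrable_const_bound[of _ 1]) (auto simp: indicator_def)
    have iG: "integrable M ?G"
      using determined_by_integrable[OF X[OF j] A] G
      by (subst Bochner_Integration.integrable_cong[OF refl, of _ _ "X j"]) auto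
    have "integrable M (\<lambda>\<omega>. ?H \<omega> * ?G \<omega>)"
      by (rule indep_var_integrable[OF ind iH iG])
    then have 1: "integrable M (\<lambda>\<omega>. ?ind j \<omega> * X j \<omega>)"
      unfolding H using G by (subst Bochner_Integration.integrable_cong[OF refl]) auto
    have "expectation (\<lambda>\<omega>. ?ind j \<omega> * X j \<omega>) = expectation (\<lambda>\<omega>. ?H \<omega> * ?G \<omega>)"
      unfolding H using G by (intro Bochner_Integration.integral_cong) auto
    also have "\<dots> = expectation ?H * expectation ?G"
      by (rule indep_var_lebesgue_integral[OF ind iH iG])
    also have "expectation ?G = expectation (X j)"
      using G by (intro Bochner_Integration.integral_cong) auto
    finally show ?thesis using 1 prob by (simp add: H)
  qed
  have AE: "AE \<omega> in M. X (I p \<omega>) \<omega> = (\<Sum>j = 1..m. ?ind j \<omega> * X j \<omega>)"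
    using AE_index[OF p(1)]
  proof eventually_elim
    case (elim \<omega>)
    then show ?case
      by (subst sum.remove[of _ "I p \<omega>"]) (auto simp: indicator_def intro!: sum.neutral)
  qed
  have "expectation (\<lambda>\<omega>. X (I p \<omega>) \<omega>) = expectation (\<lambda>\<omega>. \<Sum>j = 1..m. ?ind j \<omega> * X j \<omega>)"
  proof (intro integral_cong_AE AE)
    show "(\<lambda>\<omega>. X (I p \<omega>) \<omega>) \<in> borel_measurable M"
      using Z by (rule borel_measurable_integrable)
    show "(\<lambda>\<omega>. \<Sum>j = 1..m. ?ind j \<omega> * X j \<omega>) \<in> borel_measurable M"
      using split by (intro borel_measurable_sum borel_measurable_integrable) blast
  qed
  also have "\<dots> = (\<Sum>j = 1..m. expectation (\<lambda>\<omega>. ?ind j \<omega> * X j \<omega>))"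
    using split by (intro Bochner_Integration.integral_sum) auto
  also have "\<dots> = 1 / real m * (\<Sum>j = 1..m. expectation (X j))"
    using split by (simp add: sum_distrib_left)
  finally show ?thesis .
qed

end

section \<open>SVRG epochs\<close>

text \<open>
  The positions of the indices drawn before step \<open>t\<close> of epoch \<open>s\<close>; epochs and steps count from 1, and
  each epoch has \<open>k\<close> steps.
\<close>
definition past :: "nat \<Rightarrow> nat \<Rightarrow> nat \<Rightarrow> (nat \<times> nat) set" where
  "past k s t = {1..<s} \<times> {1..k} \<union> {s} \<times> {1..<t}"

text \<open>
  The bound \<open>Suc k\<close> includes the iterate after the last step of an epoch: it does not enter the next
  snapshot, but its distance to the minimizer ends the telescoping sum.
\<close>
lemma svrg_run_causal:
  assumes run: "svrg_run \<eta> k fs f y1 i x y" "svrg_run \<eta> k fs f y1 i' x' y'"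
    and s: "s \<ge> 1" and t: "t \<in> {1..Suc k}"
    and agree: "\<And>s' t'. (s', t') \<in> past k s t \<Longrightarrow> i s' t' = i' s' t'"
  shows "x s t = x' s t \<and> y s = y' s"
proof -
  have inner: "x s t = x' s t"
    if s: "s \<ge> 1" and y: "y s = y' s" and t: "t \<in> {1..Suc k}"
      and agree: "\<And>t'. t' \<in> {1..<t} \<Longrightarrow> i s t' = i' s t'" for s t
    using t agree
  proof (induction t)
    case (Suc t)
    show ?case
    proof (cases "t = 0")
      case True
      then show ?thesis using run s y unfolding svrg_run_def by simp
    next
      case False
      then have "x s t = x' s t" "i s t = i' s t" "t \<in> {1..k}" using Suc by auto
      then show ?thesis using run s y unfolding svrg_run_def by simp
    qed
  qed simp
  have outer: "y s = y' s"
    if "s \<ge> 1" "\<And>s' t'. (s', t') \<in> past k s 1 \<Longrightarrow> i s' t' = i' s' t'" for s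
    using that
  proof (induction s rule: nat_induct_at_least)
    case base
    then show ?case using run unfolding svrg_run_def by simp
  next
    case (Suc s)
    then have y: "y s = y' s" by (auto simp: past_def)
    have "x s t = x' s t" if "t \<in> {1..k}" for t
      using Suc that by (intro inner y) (auto simp: past_def)
    then have "(\<Sum>t = 1..k. x s t) = (\<Sum>t = 1..k. x' s t)" by simp
    then show ?case using run Suc unfolding svrg_run_def by simp
  qed
  have "y s = y' s" using s agree by (intro outer) (auto simp: past_def)
  moreover from this have "x s t = x' s t" using s t agree by (intro inner) (auto simp: past_def)
  ultimately show ?thesis by simp
qed

locale svrg =
  smooth_finite_sum fs f m \<alpha> \<beta> xstar + uniform_indices M "\<lambda>(s, t). i s t" "{1..} \<times> {1..k}" m
  for fs :: "nat \<Rightarrow> 'a::euclidean_space \<Rightarrow> real" and f m \<alpha> \<beta> xstar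
    and M :: "'w measure" and i :: "nat \<Rightarrow> nat \<Rightarrow> 'w \<Rightarrow> nat" and k :: nat +
  fixes \<eta> :: real and y1 :: 'a
    and x :: "nat \<Rightarrow> nat \<Rightarrow> 'w \<Rightarrow> 'a" and y :: "nat \<Rightarrow> 'w \<Rightarrow> 'a"
  assumes run: "\<And>\<omega>. \<omega> \<in> space M \<Longrightarrow>
      svrg_run \<eta> k fs f y1 (\<lambda>s t. i s t \<omega>) (\<lambda>s t. x s t \<omega>) (\<lambda>s. y s \<omega>)"
begin

lemma determined_by_state:
  assumes "s \<ge> 1" "t \<in> {1..Suc k}"
  shows "determined_by (past k s t) (\<lambda>\<omega>. F (x s t \<omega>) (y s \<omega>))"
  unfolding determined_by_def
proof (intro ballI impI)
  fix \<omega> \<omega>' assume \<omega>: "\<omega> \<in> space M" "\<omega>' \<in> space M"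
    and agree: "\<forall>p\<in>past k s t. (case p of (s, t) \<Rightarrow> i s t) \<omega> = (case p of (s, t) \<Rightarrow> i s t) \<omega>'"
  have "i s' t' \<omega> = i s' t' \<omega>'" if "(s', t') \<in> past k s t" for s' t'
    using agree that by fastforce
  then show "F (x s t \<omega>) (y s \<omega>) = F (x s t \<omega>') (y s \<omega>')"
    using svrg_run_causal[OF run[OF \<omega>(1)] run[OF \<omega>(2)] assms] by metis
qed

lemma past_finite: "finite (past k s t)"
  and past_subset: "s \<ge> 1 \<Longrightarrow> t \<in> {1..Suc k} \<Longrightarrow> past k s t \<subseteq> {1..} \<times> {1..k}"
  by (auto simp: past_def)

lemma integrable_state:
  fixes F :: "'a \<Rightarrow> 'a \<Rightarrow> real"
  assumes "s \<ge> 1" "t \<in> {1..Suc k}"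
  shows "integrable M (\<lambda>\<omega>. F (x s t \<omega>) (y s \<omega>))"
  using determined_by_integrable[OF determined_by_state past_finite past_subset] assms by blast

text \<open>
  The index of step \<open>t\<close> is fresh with respect to the state in which it is used, so the expectation
  over it is the average bounded in \<open>average_step_le\<close>.
\<close>
lemma expected_step_le:
  assumes s: "s \<ge> 1" and t: "t \<in> {1..k}" and \<eta>: "\<eta> \<ge> 0"
  shows "expectation (\<lambda>\<omega>. (norm (x s (Suc t) \<omega> - xstar))\<^sup>2)
    \<le> expectation (\<lambda>\<omega>. (norm (x s t \<omega> - xstar))\<^sup>2)
        - 2 * \<eta> * (1 - 2 * \<beta> * \<eta>) * (expectation (\<lambda>\<omega>. f (x s t \<omega>)) - f xstar)
        + 4 * \<beta> * \<eta>\<^sup>2 * (expectation (\<lambda>\<omega>. f (y s \<omega>)) - f xstar)"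
proof -
  define X where "X j \<omega> = (norm (x s t \<omega> - \<eta> *\<^sub>R direction j (x s t \<omega>) (y s \<omega>) - xstar))\<^sup>2" for j \<omega>
  have t': "t \<in> {1..Suc k}" "Suc t \<in> {1..Suc k}" using t by auto
  have next_iterate: "(norm (x s (Suc t) \<omega> - xstar))\<^sup>2 = X (i s t \<omega>) \<omega>" if "\<omega> \<in> space M" for \<omega>
    using run[OF that] s t unfolding svrg_run_def X_def direction_def by simp
  have "integrable M (\<lambda>\<omega>. (norm (x s (Suc t) \<omega> - xstar))\<^sup>2)"
    by (rule integrable_state[OF s t'(2), of "\<lambda>a b. (norm (a - xstar))\<^sup>2"])
  then have int: "integrable M (\<lambda>\<omega>. X (i s t \<omega>) \<omega>)"
    using next_iterate by (subst Bochner_Integration.integrable_cong[OF refl]) auto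
  have X_int: "integrable M (X j)" for j
    unfolding X_def by (rule integrable_state[OF s t'(1)])
  have "expectation (\<lambda>\<omega>. (norm (x s (Suc t) \<omega> - xstar))\<^sup>2) = expectation (\<lambda>\<omega>. X (i s t \<omega>) \<omega>)"
    using next_iterate by (intro Bochner_Integration.integral_cong) auto
  also have "\<dots> = 1 / real m * (\<Sum>j = 1..m. expectation (X j))"
  proof -
    have "determined_by (past k s t) (X j)" for j
      unfolding X_def by (rule determined_by_state[OF s t'(1)])
    moreover have "(s, t) \<in> {1..} \<times> {1..k}" "(s, t) \<notin> past k s t"
      using s t by (auto simp: past_def)
    ultimately show ?thesis
      using expectation_fresh_index[of "past k s t" X "(s, t)", OF _ past_finite past_subset[OF s t'(1)]]
        int by (simp del: One_nat_def)
  qed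
  also have "\<dots> = expectation (\<lambda>\<omega>. 1 / real m * (\<Sum>j = 1..m. X j \<omega>))"
    using X_int by simp
  also have "\<dots> \<le> expectation (\<lambda>\<omega>. (norm (x s t \<omega> - xstar))\<^sup>2
        - 2 * \<eta> * (1 - 2 * \<beta> * \<eta>) * (f (x s t \<omega>) - f xstar) + 4 * \<beta> * \<eta>\<^sup>2 * (f (y s \<omega>) - f xstar))"
    unfolding X_def by (intro integral_mono average_step_le[OF \<eta>] integrable_state[OF s t'(1)])
  also have "\<dots> = expectation (\<lambda>\<omega>. (norm (x s t \<omega> - xstar))\<^sup>2)
        - 2 * \<eta> * (1 - 2 * \<beta> * \<eta>) * (expectation (\<lambda>\<omega>. f (x s t \<omega>)) - f xstar)
        + 4 * \<beta> * \<eta>\<^sup>2 * (expectation (\<lambda>\<omega>. f (y s \<omega>)) - f xstar)"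
  proof -
    have "integrable M (\<lambda>\<omega>. (norm (x s t \<omega> - xstar))\<^sup>2)" "integrable M (\<lambda>\<omega>. f (x s t \<omega>))"
      "integrable M (\<lambda>\<omega>. f (y s \<omega>))"
      by (rule integrable_state[OF s t'(1)])+
    then show ?thesis by (simp add: prob_space)
  qed
  finally show ?thesis .
qed

text \<open>
  The first summand of the contraction factor comes from the initial distance, the second one from the
  noise caused by the snapshot; a small \<open>\<eta>\<close> makes the latter small, at the price of a longer epoch.
\<close>
lemma expected_epoch_le:
  assumes s: "s \<ge> 1" and k: "k \<ge> 1" and \<eta>: "\<eta> > 0" "2 * \<beta> * \<eta> < 1"
  shows "expectation (\<lambda>\<omega>. f (y (Suc s) \<omega>)) - f xstar
    \<le> (1 / (\<alpha> * \<eta> * (1 - 2 * \<beta> * \<eta>) * k) + 2 * \<beta> * \<eta> / (1 - 2 * \<beta> * \<eta>))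
        * (expectation (\<lambda>\<omega>. f (y s \<omega>)) - f xstar)"
proof -
  define D where "D t = expectation (\<lambda>\<omega>. (norm (x s t \<omega> - xstar))\<^sup>2)" for t
  define e where "e t = expectation (\<lambda>\<omega>. f (x s t \<omega>)) - f xstar" for t
  define g where "g = expectation (\<lambda>\<omega>. f (y s \<omega>)) - f xstar"
  define c where "c = 1 - 2 * \<beta> * \<eta>"
  have c: "c > 0" using \<eta> by (simp add: c_def)
  have one: "1 \<in> {1..Suc k}" by simp
  have telescope: "2 * \<eta> * c * (\<Sum>t = 1..n. e t) + D (Suc n) \<le> D 1 + n * (4 * \<beta> * \<eta>\<^sup>2 * g)"
    if "n \<le> k" for n
    using that
  proof (induction n)
    case (Suc n)
    have "D (Suc (Suc n)) \<le> D (Suc n) - 2 * \<eta> * c * e (Suc n) + 4 * \<beta> * \<eta>\<^sup>2 * g"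
      unfolding D_def e_def g_def c_def using Suc \<eta> by (intro expected_step_le s) auto
    then show ?case using Suc by (simp add: algebra_simps)
  qed simp
  have "D (Suc k) \<ge> 0" by (simp add: D_def)
  moreover have "D 1 \<le> 2 / \<alpha> * g"
  proof -
    have "D 1 = expectation (\<lambda>\<omega>. (norm (y s \<omega> - xstar))\<^sup>2)"
      unfolding D_def using run s by (intro Bochner_Integration.integral_cong) (auto simp: svrg_run_def)
    also have "\<dots> \<le> expectation (\<lambda>\<omega>. 2 / \<alpha> * (f (y s \<omega>) - f xstar))"
      by (intro integral_mono dist_xstar_le integrable_state[OF s one])
    also have "\<dots> = 2 / \<alpha> * g"
      using integrable_state[OF s one, of "\<lambda>_. f"] by (simp add: g_def prob_space)
    finally show ?thesis .
  qed
  ultimately have sum_le: "2 * \<eta> * c * (\<Sum>t = 1..k. e t) \<le> 2 / \<alpha> * g + k * (4 * \<beta> * \<eta>\<^sup>2 * g)"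
    using telescope[of k] by simp
  have x_int: "integrable M (\<lambda>\<omega>. f (x s t \<omega>))" if "t \<in> {1..k}" for t
    by (rule integrable_state[OF s]) (use that in auto)
  have "expectation (\<lambda>\<omega>. f (y (Suc s) \<omega>)) \<le> expectation (\<lambda>\<omega>. 1 / real k * (\<Sum>t = 1..k. f (x s t \<omega>)))"
  proof (rule integral_mono)
    show "integrable M (\<lambda>\<omega>. f (y (Suc s) \<omega>))" by (rule integrable_state[OF _ one]) simp
    show "integrable M (\<lambda>\<omega>. 1 / real k * (\<Sum>t = 1..k. f (x s t \<omega>)))"
      using x_int by (intro integrable_mult_right Bochner_Integration.integrable_sum)
    show "f (y (Suc s) \<omega>) \<le> 1 / real k * (\<Sum>t = 1..k. f (x s t \<omega>))" if "\<omega> \<in> space M" for \<omega>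
      using f_average_le[OF k] run[OF that] s by (simp add: svrg_run_def)
  qed
  also have "\<dots> = 1 / real k * (\<Sum>t = 1..k. e t + f xstar)"
    using x_int by (simp add: e_def)
  also have "\<dots> = 1 / real k * (\<Sum>t = 1..k. e t) + f xstar"
    using k by (simp add: sum.distrib field_simps)
  finally have "expectation (\<lambda>\<omega>. f (y (Suc s) \<omega>)) - f xstar \<le> 1 / real k * (\<Sum>t = 1..k. e t)"
    by simp
  also have "\<dots> \<le> 1 / real k * ((2 / \<alpha> * g + k * (4 * \<beta> * \<eta>\<^sup>2 * g)) / (2 * \<eta> * c))"
    using sum_le \<eta> c by (intro mult_left_mono) (simp_all add: pos_le_divide_eq mult.commute)
  also have "\<dots> = (1 / (\<alpha> * \<eta> * c * k) + 2 * \<beta> * \<eta> / c) * g"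
    using \<alpha> \<eta> c k by (simp add: field_simps power2_eq_square)
  finally show ?thesis by (simp add: c_def g_def)
qed

end

theorem theorem6p5:
  fixes fs :: "nat \<Rightarrow> real ^ 'n \<Rightarrow> real"
    and f :: "real ^ 'n \<Rightarrow> real"
    and m k :: nat
    and \<alpha> \<beta> \<kappa> \<eta> :: real
    and xstar y1 :: "real ^ 'n"
    and M :: "'w measure"
    and i :: "nat \<Rightarrow> nat \<Rightarrow> 'w \<Rightarrow> nat"
    and x :: "nat \<Rightarrow> nat \<Rightarrow> 'w \<Rightarrow> real ^ 'n"
    and y :: "nat \<Rightarrow> 'w \<Rightarrow> real ^ 'n"
  assumes m: "m \<ge> 1"
    and \<alpha>: "\<alpha> > 0"
    and \<beta>: "\<beta> > 0"
    and smooth: "\<And>j. j \<in> {1..m} \<Longrightarrow> smooth \<beta> (fs j)"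
    and convex: "\<And>j. j \<in> {1..m} \<Longrightarrow> convex_on UNIV (fs j)"
    and f: "f = (\<lambda>z. 1 / real m * (\<Sum>j = 1..m. fs j z))"
    and strongly_convex: "strongly_convex \<alpha> f"
    and minimizer: "\<And>z. f xstar \<le> f z"
    and \<kappa>: "\<kappa> = \<beta> / \<alpha>"
    and \<eta>: "\<eta> = 1 / (10 * \<beta>)"
    and k: "real k = 20 * \<kappa>"
    and prob_space: "prob_space M"
    and indep: "prob_space.indep_vars M (\<lambda>_. count_space UNIV) (\<lambda>(s, t). i s t) ({1..} \<times> {1..k})"
    and uniform: "\<And>s t. s \<ge> 1 \<Longrightarrow> t \<in> {1..k} \<Longrightarrow>
      distr M (count_space UNIV) (i s t) = measure_pmf (pmf_of_set {1..m})"
    and run: "\<And>\<omega>. \<omega> \<in> space M \<Longrightarrow>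
      svrg_run \<eta> k fs f y1 (\<lambda>s t. i s t \<omega>) (\<lambda>s t. x s t \<omega>) (\<lambda>s. y s \<omega>)"
  shows "\<forall>s\<ge>1. prob_space.expectation M (\<lambda>\<omega>. f (y (s + 1) \<omega>)) - f xstar
           \<le> 0.9 ^ s * (f y1 - f xstar)"
proof -
  interpret svrg fs f m \<alpha> \<beta> xstar M i k \<eta> y1 x y
    using assms by (auto simp: svrg_def smooth_finite_sum_def uniform_indices_def
        uniform_indices_axioms_def svrg_axioms_def)
  have k_pos: "k \<ge> 1"
    using k \<kappa> \<alpha> \<beta> by (cases k) auto
  have \<eta>': "\<eta> > 0" "2 * \<beta> * \<eta> < 1"
    using \<beta> by (simp_all add: \<eta>)
  have rate: "1 / (\<alpha> * \<eta> * (1 - 2 * \<beta> * \<eta>) * k) + 2 * \<beta> * \<eta> / (1 - 2 * \<beta> * \<eta>) \<le> 0.9"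
    using \<alpha> \<beta> by (simp add: \<eta> k \<kappa>)
  \<comment> \<open>Enlarging the contraction factor requires that the suboptimality is nonnegative.\<close>
  have epoch: "expectation (\<lambda>\<omega>. f (y (Suc s) \<omega>)) - f xstar
      \<le> 0.9 * (expectation (\<lambda>\<omega>. f (y s \<omega>)) - f xstar)" if s: "s \<ge> 1" for s
  proof -
    have "expectation (\<lambda>\<omega>. f xstar) \<le> expectation (\<lambda>\<omega>. f (y s \<omega>))"
      by (intro integral_mono minimizer integrable_const integrable_state[OF s, of 1]) simp
    then have "0 \<le> expectation (\<lambda>\<omega>. f (y s \<omega>)) - f xstar" by (simp add: prob_space)
    then show ?thesis
      using expected_epoch_le[OF s k_pos \<eta>'] mult_right_mono[OF rate] order_trans by blast
  qed
  have "expectation (\<lambda>\<omega>. f (y 1 \<omega>)) = expectation (\<lambda>\<omega>. f y1)"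
    using run by (intro Bochner_Integration.integral_cong) (auto simp: svrg_run_def)
  then have first: "expectation (\<lambda>\<omega>. f (y 1 \<omega>)) = f y1" by (simp add: prob_space)
  have "expectation (\<lambda>\<omega>. f (y (Suc s) \<omega>)) - f xstar \<le> 0.9 ^ s * (f y1 - f xstar)" for s
  proof (induction s)
    case 0
    then show ?case using first by simp
  next
    case (Suc s)
    then show ?case using epoch[of "Suc s"] by simp
  qed
  then show ?thesis by simp
qed

end
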